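(* Let $\ell\ge1$. The fair 3-input multiplication protocol $\Pi_{\mathsf{Mult3}}(\mathsf a,\mathsf b,\mathsf c,\mathsf{isTr})$ (described in the context) on $[\![\cdot]\!]$-shared inputs $\mathsf a,\mathsf b,\mathsf c\in\mathbb Z_{2^\ell}$, for either value of the truncation bit $\mathsf{isTr}\in\{0,1\}$, requires (in the amortized sense) $9\ell$ bits of communication in preprocessing, and $1$ round and $3\ell$ bits of communication in the online phase.
   Context: Setting: four parties $P_0,P_1,P_2,P_3$ with pairwise private authenticated synchronous channels; every subset of at least two parties holds a common pseudorandom-function key (one-time setup), so any such subset can sample common random elements without communication. $\mathsf H$ is a collision-resistant hash function with output of fixed length. For $\mathsf x\in\mathbb Z_{2^\ell}$, $\mathsf x^{\mathsf t}$ is $\mathsf x$ (as a signed two's complement integer) truncated by a fixed number of low-order bits. Sharing: $\mathsf{v}\in\mathbb{Z}_{2^\ell}$ is $[\![\cdot]\!]$-shared via $\lambda^1_{\mathsf v},\lambda^2_{\mathsf v},\lambda^3_{\mathsf v}$ and $\mathsf{m}_{\mathsf v}=\mathsf v+\lambda_{\mathsf v}$, $\lambda_{\mathsf v}=\lambda^1_{\mathsf v}+\lambda^2_{\mathsf v}+\lambda^3_{\mathsf v}$, where $P_0$ holds $(\lambda^1_{\mathsf v},\lambda^2_{\mathsf v},\lambda^3_{\mathsf v})$, $P_1$ holds $(\mathsf m_{\mathsf v},\lambda^1_{\mathsf v},\lambda^3_{\mathsf v})$, $P_2$ holds $(\mathsf m_{\mathsf v},\lambda^2_{\mathsf v},\lambda^3_{\mathsf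 v})$, $P_3$ holds $(\mathsf m_{\mathsf v},\lambda^1_{\mathsf v},\lambda^2_{\mathsf v})$. The sharing is linear. A value $\mathsf x=\mathsf x^1+\mathsf x^2+\mathsf x^3$ is $\langle\cdot\rangle$-shared if $P_1,P_2,P_3$ hold $(\mathsf x^1,\mathsf x^3)$, $(\mathsf x^2,\mathsf x^3)$, $(\mathsf x^1,\mathsf x^2)$ respectively. Write $\mathsf m_{\mathsf{ab}}=\mathsf m_{\mathsf a}\mathsf m_{\mathsf b}$, $\mathsf m_{\mathsf{abc}}=\mathsf m_{\mathsf a}\mathsf m_{\mathsf b}\mathsf m_{\mathsf c}$, etc. Joint-send: "$P_i,P_j$ $\mathsf{jsnd}$ $\mathsf x$ to $P_k$" means $P_i$ sends $\mathsf x$ to $P_k$ and $P_j$ sends $\mathsf H(\mathsf x)$ to $P_k$, who aborts if they are inconsistent; hashes are combined over all instances and sent once at the end. Joint sharing $\Pi_{\mathsf{JSh}}$: $\Pi_{\mathsf{JSh}}(P_0,P_3,\mathsf v)$ (preprocessing): $P_0,P_2,P_3$ sample $\lambda^2_{\mathsf v}$; set $\lambda^3_{\mathsf v}=\mathsf m_{\mathsf v}=0$; $P_0,P_3$ $\mathsf{jsnd}$ $\lambda^1_{\mathsf v}=-\mathsf v-\lambda^2_{\mathsf v}$ to $P_1$. $\Pi_{\mathsf{JSh}}(P_1,P_2,\mathsf v)$ (online): in preprocessing the $\lambda$-shares are sampled non-interactively so that $P_1,P_2$ both know all of $\lambda_{\mathsf v}$; online $P_1,P_2$ $\mathsf{jsnd}$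 $\mathsf m_{\mathsf v}=\mathsf v+\lambda_{\mathsf v}$ to $P_3$. Protocol $\Pi_{\mathsf{MulR}}(\langle\mathsf x\rangle,\langle\mathsf y\rangle)$ ($P_0$ knows all shares): the parties non-interactively obtain $Z_1,Z_2,Z_3$ with $Z_1+Z_2+Z_3=0$, $Z_j$ known to $P_0,P_j$. $P_0,P_1$ $\mathsf{jsnd}$ $\mathsf x^1\mathsf y^3+\mathsf x^3\mathsf y^1+\mathsf x^3\mathsf y^3+Z_1$ to $P_2$; $P_0,P_2$ $\mathsf{jsnd}$ $\mathsf x^2\mathsf y^3+\mathsf x^3\mathsf y^2+\mathsf x^2\mathsf y^2+Z_2$ to $P_3$; $P_0,P_3$ $\mathsf{jsnd}$ $\mathsf x^1\mathsf y^2+\mathsf x^2\mathsf y^1+\mathsf x^1\mathsf y^1+Z_3$ to $P_1$. These three values are, in order, the shares $\mathsf z^3,\mathsf z^2,\mathsf z^1$ of $\langle\mathsf{xy}\rangle$. Protocol $\Pi_{\mathsf{Mult3}}$ for $\mathsf z=\mathsf{abc}$. Preprocessing: (1) Run $\Pi_{\mathsf{MulR}}$ on $\lambda_{\mathsf a},\lambda_{\mathsf b}$, giving $\langle\gamma_{\mathsf{ab}}\rangle=(\gamma_{\mathsf{ab}}^1,\gamma_{\mathsf{ab}}^2,\gamma_{\mathsf{ab}}^3)$. (2) For $\gamma_{\mathsf{ac}}$: locally $P_0,P_1$ compute $\gamma_{\mathsf{ac}}^1=\lambda_{\mathsf a}^1\lambda_{\mathsf c}^3+\lambda_{\mathsf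 a}^3\lambda_{\mathsf c}^1+\lambda_{\mathsf a}^3\lambda_{\mathsf c}^3$, $P_0,P_2$ compute $\gamma_{\mathsf{ac}}^2=\lambda_{\mathsf a}^2\lambda_{\mathsf c}^3+\lambda_{\mathsf a}^3\lambda_{\mathsf c}^2+\lambda_{\mathsf a}^2\lambda_{\mathsf c}^2$, $P_0,P_3$ compute $\gamma_{\mathsf{ac}}^3=\lambda_{\mathsf a}^1\lambda_{\mathsf c}^2+\lambda_{\mathsf a}^2\lambda_{\mathsf c}^1+\lambda_{\mathsf a}^1\lambda_{\mathsf c}^1$; $P_0,P_3,P_1$ sample random $\mathsf u_{\mathsf{ac}}^1$; $P_0,P_3$ $\mathsf{jsnd}$ $\mathsf u_{\mathsf{ac}}^2=\gamma_{\mathsf{ac}}^3-\mathsf u_{\mathsf{ac}}^1$ to $P_2$; $P_0,P_1,P_2$ sample random $\mathsf s_{\mathsf{ac}}$ (as a sum of two random elements); $P_0$ sends $\mathsf w_{\mathsf{ac}}=\gamma_{\mathsf{ac}}^1+\gamma_{\mathsf{ac}}^2+\mathsf s_{\mathsf{ac}}$ to $P_3$. (3) The same as (2) for $\gamma_{\mathsf{bc}}$ ($\mathsf b$ in place of $\mathsf a$). (4) For $\gamma_{\mathsf{abc}}$: locally $P_0,P_1$ compute $\gamma_{\mathsf{abc}}^1=\gamma_{\mathsf{ab}}^1\lambda_{\mathsf c}^3+\gamma_{\mathsf{ab}}^3\lambda_{\mathsf c}^1+\gamma_{\mathsf{ab}}^3\lambda_{\mathsf c}^3$, $P_0,P_2$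 compute $\gamma_{\mathsf{abc}}^2=\gamma_{\mathsf{ab}}^2\lambda_{\mathsf c}^3+\gamma_{\mathsf{ab}}^3\lambda_{\mathsf c}^2+\gamma_{\mathsf{ab}}^2\lambda_{\mathsf c}^2$, $P_0,P_3$ compute $\gamma_{\mathsf{abc}}^3=\gamma_{\mathsf{ab}}^1\lambda_{\mathsf c}^2+\gamma_{\mathsf{ab}}^2\lambda_{\mathsf c}^1+\gamma_{\mathsf{ab}}^1\lambda_{\mathsf c}^1$; $P_0,P_3,P_j$ sample random $\mathsf u_{\mathsf{abc}}^j$, $j\in\{1,2\}$; $P_0,P_1,P_2$ sample random $\mathsf s$; $P_0$ sends $\mathsf w_{\mathsf{abc}}=\gamma_{\mathsf{abc}}^1+\gamma_{\mathsf{abc}}^2+\mathsf s$ to $P_3$. (5) $P_0,P_3$ compute $\mathsf r=\mathsf u_{\mathsf{abc}}^1+\mathsf u_{\mathsf{abc}}^2-\gamma_{\mathsf{abc}}^3$, set $\mathsf q=\mathsf r^{\mathsf t}$ if $\mathsf{isTr}=1$, else $\mathsf q=\mathsf r$, and execute $\Pi_{\mathsf{JSh}}(P_0,P_3,\mathsf q)$. Online: (1) For $j=1,2$, $P_j$ computes $\mathsf y_j=-\lambda_{\mathsf a}^j\mathsf m_{\mathsf{bc}}-\lambda_{\mathsf b}^j\mathsf m_{\mathsf{ac}}-\lambda_{\mathsf c}^j\mathsf m_{\mathsf{ab}}+\gamma_{\mathsf{ab}}^j\mathsf m_{\mathsf c}+(\gamma_{\mathsf{ac}}^j+\mathsf u_{\mathsf{ac}}^j)\mathsf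 m_{\mathsf b}+(\gamma_{\mathsf{bc}}^j+\mathsf u_{\mathsf{bc}}^j)\mathsf m_{\mathsf a}-(\gamma_{\mathsf{abc}}^j+\mathsf u_{\mathsf{abc}}^j)$; $P_1,P_2$ compute $\mathsf y_3=-\lambda_{\mathsf a}^3\mathsf m_{\mathsf{bc}}-\lambda_{\mathsf b}^3\mathsf m_{\mathsf{ac}}-\lambda_{\mathsf c}^3\mathsf m_{\mathsf{ab}}+\gamma_{\mathsf{ab}}^3\mathsf m_{\mathsf c}$. (2) $P_1$ sends $\mathsf y_1$ to $P_2$, $P_2$ sends $\mathsf y_2$ to $P_1$; they compute $\mathsf z-\mathsf r=\mathsf y_1+\mathsf y_2+\mathsf y_3+\mathsf m_{\mathsf{abc}}$. (3) They set $\mathsf p=(\mathsf z-\mathsf r)^{\mathsf t}$ if $\mathsf{isTr}=1$, else $\mathsf p=\mathsf z-\mathsf r$, and execute $\Pi_{\mathsf{JSh}}(P_1,P_2,\mathsf p)$. (4) Output $[\![\mathsf p]\!]+[\![\mathsf q]\!]$. (5) Verification: $P_3$ computes $\mathsf v=-(\lambda_{\mathsf a}^1+\lambda_{\mathsf a}^2)\mathsf m_{\mathsf{bc}}-(\lambda_{\mathsf b}^1+\lambda_{\mathsf b}^2)\mathsf m_{\mathsf{ac}}-(\lambda_{\mathsf c}^1+\lambda_{\mathsf c}^2)\mathsf m_{\mathsf{ab}}+(\gamma_{\mathsf{ab}}^1+\gamma_{\mathsf{ab}}^2)\mathsf m_{\mathsf c}+(\mathsf w_{\mathsf{ac}}+\gamma_{\mathsf{ac}}^3)\mathsf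 m_{\mathsf b}+(\mathsf w_{\mathsf{bc}}+\gamma_{\mathsf{bc}}^3)\mathsf m_{\mathsf a}-(\mathsf u_{\mathsf{abc}}^1+\mathsf u_{\mathsf{abc}}^2+\mathsf w_{\mathsf{abc}})$ and sends $\mathsf H(\mathsf v)$ to $P_1,P_2$, who abort iff it differs from $\mathsf H(\mathsf y_1+\mathsf y_2+\mathsf s_{\mathsf{ac}}\mathsf m_{\mathsf b}+\mathsf s_{\mathsf{bc}}\mathsf m_{\mathsf a}-\mathsf s)$. Cost convention (amortized): communication is the limit, as the number $N$ of protocol instances tends to infinity, of (total bits sent)$/N$, where all hash messages are batched and sent once at the end of the whole computation. The communication to $P_3$ in $\Pi_{\mathsf{JSh}}(P_1,P_2,\mathsf p)$ is deferred to the verification stage at the end of the computation; its bits are counted in the online communication, but the rounds of the one-time verification stage are not counted. *)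

theory Defs
  imports Complex_Main "HOL-Library.Word" "HOL-Library.Extended_Nat" "HOL-Library.State_Monad"
begin

text \<open>
  The ring of integers modulo \<open>2 ^ \<ell>\<close> is \<open>'l word\<close> with \<open>\<ell> = LENGTH('l)\<close>; class \<open>len\<close> says
  \<open>\<ell> \<ge> 1\<close>.  The model describes executions in which all parties follow the protocol, so that a
  value held by several parties is the same at all of them.
\<close>

datatype party = P0 | P1 | P2 | P3

text \<open>
  \<open>Verification\<close> is the one-time stage at the end of the whole computation (all instances).
\<close>

datatype stage = Preprocessing | Online | Verification

fun stage_index :: "stage \<Rightarrow> nat" where
  "stage_index Preprocessing = 0"
| "stage_index Online = 1"
| "stage_index Verification = 2"

text \<open>
  A value together with the information when each party is able to compute it:
  \<open>avail w i s\<close> is the number of communication rounds of stage \<open>s\<close> after which party \<open>i\<close> can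
  compute \<open>w\<close>; it is \<open>0\<close> if \<open>i\<close> can do so before stage \<open>s\<close> begins or without communication in
  stage \<open>s\<close>, and \<open>\<infinity>\<close> if \<open>i\<close> cannot compute \<open>w\<close> during stage \<open>s\<close>.
\<close>

datatype 'r wire = Wire (val: 'r) (avail: "party \<Rightarrow> stage \<Rightarrow> enat")

definition held_by :: "party set \<Rightarrow> stage \<Rightarrow> 'r \<Rightarrow> 'r wire" where
  "held_by S s x =
    Wire x (\<lambda>i s'. if i \<in> S \<and> stage_index s \<le> stage_index s' then 0 else \<infinity>)"

text \<open>
  Local computation: whoever has all operands has the result, as soon as the last operand is there
  (\<open>sup\<close> is the pointwise maximum).
\<close>

instantiation wire :: (ring) "{zero, plus, minus, uminus, times}"
begin

definition "0 = Wire 0 (\<lambda>_ _. 0)"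
definition "x + y = Wire (val x + val y) (sup (avail x) (avail y))"
definition "x - y = Wire (val x - val y) (sup (avail x) (avail y))"
definition "- x = Wire (- val x) (avail x)"
definition "x * y = Wire (val x * val y) (sup (avail x) (avail y))"

instance ..

end

definition truncate :: "nat \<Rightarrow> 'l::len word wire \<Rightarrow> 'l word wire" where
  "truncate d x = Wire (signed_drop_bit d (val x)) (avail x)"


text \<open>
  \<open>Send s i k w\<close>: in stage \<open>s\<close>, party \<open>i\<close> sends the ring element \<open>w\<close> to \<open>k\<close>.
  \<open>Digest s j k w w'\<close>: \<open>w\<close> enters the batched hash that \<open>j\<close> sends to \<open>k\<close> at the very end, and \<open>k\<close>
  aborts unless it matches the hash of its own value \<open>w'\<close>; \<open>s\<close> is the stage to whose cost this hash belongs.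
\<close>

datatype 'r event =
    Send stage party party "'r wire"
  | Digest stage party party "'r wire" "'r wire"

text \<open>
  The state of a run consists of the number of common random elements drawn so far and the
  transcript.  Randomness is given by \<open>\<rho>\<close>: \<open>\<rho> S n\<close> is the \<open>n\<close>-th element of the pseudorandom
  sequence that exactly the members of \<open>S\<close> can compute from their common key.
\<close>

type_synonym ('r, 'a) protocol = "(nat \<times> 'r event list, 'a) state"

type_synonym 'r coins = "party set \<Rightarrow> nat \<Rightarrow> 'r"

definition sample :: "'r coins \<Rightarrow> party set \<Rightarrow> ('r, 'r wire) protocol" where
  "sample \<rho> S = State (\<lambda>(n, es). (held_by S Preprocessing (\<rho> S n), (Suc n, es)))"

definition emit :: "'r event \<Rightarrow> ('r, unit) protocol" where
  "emit e = State (\<lambda>(n, es). ((), (n, es @ [e])))"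

text \<open>
  A message of stage \<open>s\<close> is sent as soon as its sender can compute it and is delivered one round
  later; the receiver keeps it for all later stages.
\<close>

definition deliver :: "stage \<Rightarrow> party \<Rightarrow> party \<Rightarrow> 'r wire \<Rightarrow> 'r wire" where
  "deliver s i k w = Wire (val w) ((avail w)(k := (\<lambda>s'.
     min (avail w k s')
       (if stage_index s' < stage_index s \<or> avail w i s = \<infinity> then \<infinity>
        else if s' = s then avail w i s + 1 else 0))))"

definition send :: "stage \<Rightarrow> party \<Rightarrow> party \<Rightarrow> 'r wire \<Rightarrow> ('r, 'r wire) protocol" where
  "send s i k w = do { emit (Send s i k w); State_Monad.return (deliver s i k w) }"

definition jsnd ::
  "stage \<Rightarrow> party \<Rightarrow> party \<Rightarrow> party \<Rightarrow> 'r wire \<Rightarrow> ('r, 'r wire) protocol" where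
  "jsnd s i j k w = do {
     w' \<leftarrow> send s i k w;
     emit (Digest s j k w w');
     State_Monad.return w'
   }"


text \<open>
  A \<open>\<langle>\<cdot>\<rangle>\<close>-sharing is the triple of its shares with upper indices 1, 2, 3; a \<open>\<lbrakk>\<cdot>\<rbrakk>\<close>-sharing is the
  masked value \<open>m\<close> together with the triple of the \<open>\<lambda>\<close>-shares.
\<close>

type_synonym 'r triple = "'r wire \<times> 'r wire \<times> 'r wire"
type_synonym 'r sharing = "'r wire \<times> 'r triple"

text \<open>The \<open>\<lambda>\<close>-shares do not depend on the secret and are present from preprocessing on.\<close>

fun share :: "'r::ring \<Rightarrow> 'r \<times> 'r \<times> 'r \<Rightarrow> 'r sharing" where
  "share v (l1, l2, l3) =
    (held_by {P1, P2, P3} Online (v + (l1 + l2 + l3)),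
     held_by {P0, P1, P3} Preprocessing l1,
     held_by {P0, P2, P3} Preprocessing l2,
     held_by {P0, P1, P2} Preprocessing l3)"

fun add_sharing :: "'r::ring sharing \<Rightarrow> 'r sharing \<Rightarrow> 'r sharing" where
  "add_sharing (m, l1, l2, l3) (m', l1', l2', l3') = (m + m', l1 + l1', l2 + l2', l3 + l3')"

fun shared_value :: "'r::ring sharing \<Rightarrow> 'r" where
  "shared_value (m, l1, l2, l3) = val m - (val l1 + val l2 + val l3)"

definition jsh_03 :: "'r::ring coins \<Rightarrow> 'r wire \<Rightarrow> ('r, 'r sharing) protocol" where
  "jsh_03 \<rho> v = do {
     l2 \<leftarrow> sample \<rho> {P0, P2, P3};
     l1 \<leftarrow> jsnd Preprocessing P0 P3 P1 (- v - l2);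
     State_Monad.return (0, l1, l2, 0)
   }"

text \<open>
  \<open>P1\<close> and \<open>P2\<close> must know all three \<open>\<lambda>\<close>-shares, besides the parties that hold them anyway.
\<close>

definition jsh_12_preprocessing :: "'r::ring coins \<Rightarrow> ('r, 'r triple) protocol" where
  "jsh_12_preprocessing \<rho> = do {
     l1 \<leftarrow> sample \<rho> {P0, P1, P2, P3};
     l2 \<leftarrow> sample \<rho> {P0, P1, P2, P3};
     l3 \<leftarrow> sample \<rho> {P0, P1, P2};
     State_Monad.return (l1, l2, l3)
   }"

text \<open>The message to \<open>P3\<close> is deferred to the verification stage.\<close>

fun jsh_12_online :: "'r::ring triple \<Rightarrow> 'r wire \<Rightarrow> ('r, 'r sharing) protocol" where
  "jsh_12_online (l1, l2, l3) v = do {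
     m \<leftarrow> jsnd Verification P1 P2 P3 (v + (l1 + l2 + l3));
     State_Monad.return (m, l1, l2, l3)
   }"


text \<open>
  The three parts of the product of two \<open>\<langle>\<cdot>\<rangle>\<close>-shared values computable by \<open>P1\<close>, \<open>P2\<close>, \<open>P3\<close>.
\<close>

fun part1 :: "'r::ring triple \<Rightarrow> 'r triple \<Rightarrow> 'r wire" where
  "part1 (x1, x2, x3) (y1, y2, y3) = x1 * y3 + x3 * y1 + x3 * y3"

fun part2 :: "'r::ring triple \<Rightarrow> 'r triple \<Rightarrow> 'r wire" where
  "part2 (x1, x2, x3) (y1, y2, y3) = x2 * y3 + x3 * y2 + x2 * y2"

fun part3 :: "'r::ring triple \<Rightarrow> 'r triple \<Rightarrow> 'r wire" where
  "part3 (x1, x2, x3) (y1, y2, y3) = x1 * y2 + x2 * y1 + x1 * y1"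

text \<open>
  Each of \<open>P1\<close>, \<open>P2\<close>, \<open>P3\<close> takes part in two of the three samplings and hence knows exactly one of
  the differences.
\<close>

definition zero_shares :: "'r::ring coins \<Rightarrow> ('r, 'r triple) protocol" where
  "zero_shares \<rho> = do {
     f \<leftarrow> sample \<rho> {P0, P1, P2};
     g \<leftarrow> sample \<rho> {P0, P2, P3};
     h \<leftarrow> sample \<rho> {P0, P1, P3};
     State_Monad.return (f - h, g - f, h - g)
   }"

definition mulR :: "'r::ring coins \<Rightarrow> 'r triple \<Rightarrow> 'r triple \<Rightarrow> ('r, 'r triple) protocol" where
  "mulR \<rho> x y = do {
     (Z1, Z2, Z3) \<leftarrow> zero_shares \<rho>;
     z3 \<leftarrow> jsnd Preprocessing P0 P1 P2 (part1 x y + Z1);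
     z2 \<leftarrow> jsnd Preprocessing P0 P2 P3 (part2 x y + Z2);
     z1 \<leftarrow> jsnd Preprocessing P0 P3 P1 (part3 x y + Z3);
     State_Monad.return (z1, z2, z3)
   }"

text \<open>
  Preprocessing of \<open>\<gamma>\<^sub>a\<^sub>c\<close> and of \<open>\<gamma>\<^sub>b\<^sub>c\<close>; the result consists of \<open>u\<^sup>1\<close>, \<open>u\<^sup>2\<close>, \<open>s\<close>, \<open>w\<close>.
\<close>

definition gamma_pair ::
  "'r::ring coins \<Rightarrow> 'r triple \<Rightarrow> 'r triple \<Rightarrow> ('r, 'r wire \<times> 'r wire \<times> 'r wire \<times> 'r wire) protocol"
where
  "gamma_pair \<rho> x y = do {
     u1 \<leftarrow> sample \<rho> {P0, P1, P3};
     u2 \<leftarrow> jsnd Preprocessing P0 P3 P2 (part3 x y - u1);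
     s' \<leftarrow> sample \<rho> {P0, P1, P2};
     s'' \<leftarrow> sample \<rho> {P0, P1, P2};
     let s = s' + s'';
     w \<leftarrow> send Preprocessing P0 P3 (part1 x y + part2 x y + s);
     State_Monad.return (u1, u2, s, w)
   }"

text \<open>\<open>d\<close> is the number of low-order bits removed by truncation.\<close>

definition mult3 ::
  "'l::len word coins \<Rightarrow> nat \<Rightarrow> bool \<Rightarrow>
   'l word sharing \<Rightarrow> 'l word sharing \<Rightarrow> 'l word sharing \<Rightarrow> ('l word, 'l word sharing) protocol"
where
  "mult3 \<rho> d isTr a b c = do {
     let (ma, la) = a; let (la1, la2, la3) = la;
     let (mb, lb) = b; let (lb1, lb2, lb3) = lb;
     let (mc, lc) = c; let (lc1, lc2, lc3) = lc;

     gab \<leftarrow> mulR \<rho> la lb;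
     let (gab1, gab2, gab3) = gab;
     (uac1, uac2, sac, wac) \<leftarrow> gamma_pair \<rho> la lc;
     (ubc1, ubc2, sbc, wbc) \<leftarrow> gamma_pair \<rho> lb lc;
     uabc1 \<leftarrow> sample \<rho> {P0, P1, P3};
     uabc2 \<leftarrow> sample \<rho> {P0, P2, P3};
     s \<leftarrow> sample \<rho> {P0, P1, P2};
     wabc \<leftarrow> send Preprocessing P0 P3 (part1 gab lc + part2 gab lc + s);
     let r = uabc1 + uabc2 - part3 gab lc;
     q \<leftarrow> jsh_03 \<rho> (if isTr then truncate d r else r);
     lp \<leftarrow> jsh_12_preprocessing \<rho>;

     let y1 = - (la1 * (mb * mc)) - lb1 * (ma * mc) - lc1 * (ma * mb)
        + gab1 * mc + (part1 la lc + uac1) * mb + (part1 lb lc + ubc1) * ma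
        - (part1 gab lc + uabc1);
     let y2 = - (la2 * (mb * mc)) - lb2 * (ma * mc) - lc2 * (ma * mb)
        + gab2 * mc + (part2 la lc + uac2) * mb + (part2 lb lc + ubc2) * ma
        - (part2 gab lc + uabc2);
     let y3 = - (la3 * (mb * mc)) - lb3 * (ma * mc) - lc3 * (ma * mb) + gab3 * mc;
     y1 \<leftarrow> send Online P1 P2 y1;
     y2 \<leftarrow> send Online P2 P1 y2;
     let z_minus_r = y1 + y2 + y3 + ma * mb * mc;
     p \<leftarrow> jsh_12_online lp (if isTr then truncate d z_minus_r else z_minus_r);

     let v = - ((la1 + la2) * (mb * mc)) - (lb1 + lb2) * (ma * mc) - (lc1 + lc2) * (ma * mb)
        + (gab1 + gab2) * mc + (wac + part3 la lc) * mb + (wbc + part3 lb lc) * ma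
        - (uabc1 + uabc2 + wabc);
     let v' = y1 + y2 + sac * mb + sbc * ma - s;
     emit (Digest Verification P3 P1 v v');
     emit (Digest Verification P3 P2 v v');
     State_Monad.return (add_sharing p q)
   }"

definition transcript :: "('r, 'a) protocol \<Rightarrow> 'r event list" where
  "transcript \<pi> = snd (snd (run_state \<pi> (0, [])))"

definition result :: "('r, 'a) protocol \<Rightarrow> 'a" where
  "result \<pi> = fst (run_state \<pi> (0, []))"


definition bits :: "'l::len word wire \<Rightarrow> bool list" where
  "bits w = map (bit (val w)) [0..<LENGTH('l)]"

fun sent_data :: "stage set \<Rightarrow> 'l::len word event \<Rightarrow> bool list list" where
  "sent_data S (Send s i k w) = (if s \<in> S then [bits w] else [])"
| "sent_data S (Digest s j k w w') = []"

fun digested :: "stage set \<Rightarrow> party \<Rightarrow> party \<Rightarrow> 'l::len word event \<Rightarrow> bool list list" where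
  "digested S j k (Send s i' k' w) = []"
| "digested S j k (Digest s j' k' w w') =
    (if s \<in> S \<and> j' = j \<and> k' = k then [bits w] else [])"

text \<open>
  The hash messages for a transcript (of arbitrarily many instances): for every sender \<open>j\<close> and
  receiver \<open>k\<close> a single hash of everything that \<open>j\<close> has to confirm to \<open>k\<close>.
\<close>

definition hash_messages ::
  "(bool list \<Rightarrow> bool list) \<Rightarrow> stage set \<Rightarrow> 'l::len word event list \<Rightarrow> bool list list" where
  "hash_messages H S es =
    [H (concat (concat (map (digested S j k) es))).
      j \<leftarrow> [P0, P1, P2, P3], k \<leftarrow> [P0, P1, P2, P3], concat (map (digested S j k) es) \<noteq> []]"

text \<open>
  The total number of bits sent in the stages \<open>S\<close>.  Hashes are attributed to the stage they
  originate from, although they are sent at the end, so that no message goes uncounted in the phase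
  that causes it.
\<close>

definition communication ::
  "(bool list \<Rightarrow> bool list) \<Rightarrow> stage set \<Rightarrow> 'l::len word event list \<Rightarrow> nat" where
  "communication H S es =
    sum_list (map length (concat (map (sent_data S) es) @ hash_messages H S es))"

text \<open>The number of the round of stage \<open>s\<close> in which the last message of stage \<open>s\<close> is sent.\<close>

definition rounds :: "stage \<Rightarrow> 'r event list \<Rightarrow> enat" where
  "rounds s es = Sup {avail w i s + 1 | i k w. Send s i k w \<in> set es}"


text \<open>
  The remaining facts confirm that the protocol is modelled consistently: every message, and every
  value that is hashed or checked, can be computed by the party concerned in time, and without
  truncation the output is a sharing of the product.
\<close>

definition knows :: "party \<Rightarrow> stage \<Rightarrow> 'r wire \<Rightarrow> bool" where
  "knows j t w \<longleftrightarrow> avail w j t \<noteq> \<infinity>"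

fun feasible :: "'r event \<Rightarrow> bool" where
  "feasible (Send s i k w) \<longleftrightarrow> knows i s w"
| "feasible (Digest s j k w w') \<longleftrightarrow> knows j Verification w \<and> knows k Verification w'"

lemma run_bind:
  "run_state (State_Monad.bind x f) s = (case run_state x s of (a, s') \<Rightarrow> run_state (f a) s')"
  by (cases x) simp

lemma run_sample:
  "run_state (sample \<rho> S) (n, es) = (held_by S Preprocessing (\<rho> S n), (Suc n, es))"
  by (simp add: sample_def)

lemma run_emit: "run_state (emit e) (n, es) = ((), (n, es @ [e]))"
  by (simp add: emit_def)

lemma run_send:
  "run_state (send s i k w) (n, es) = (deliver s i k w, (n, es @ [Send s i k w]))"
  by (simp add: send_def run_bind run_emit)

lemma run_jsnd:
  "run_state (jsnd s i j k w) (n, es) =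
    (deliver s i k w, (n, es @ [Send s i k w, Digest s j k w (deliver s i k w)]))"
  by (simp add: jsnd_def run_bind run_emit run_send)

lemmas run_simps =
  mult3_def mulR_def zero_shares_def gamma_pair_def jsh_03_def jsh_12_preprocessing_def
  run_bind run_sample run_emit run_send run_jsnd result_def transcript_def Let_def

lemma val_simps:
  fixes x y :: "'r::ring wire" and z :: "'l::len word wire"
  shows "val (0 :: 'r wire) = 0" "val (x + y) = val x + val y" "val (x - y) = val x - val y"
    "val (- x) = - val x" "val (x * y) = val x * val y"
    "val (truncate d z) = signed_drop_bit d (val z)"
    "val (held_by S s v) = v" "val (deliver s i k w) = val w"
  by (simp_all add: zero_wire_def plus_wire_def minus_wire_def uminus_wire_def times_wire_def
      truncate_def held_by_def deliver_def)

lemma knows_simps: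
  fixes x y :: "'r::ring wire" and z :: "'l::len word wire"
  shows "knows j t (0 :: 'r wire)" "knows j t (x + y) \<longleftrightarrow> knows j t x \<and> knows j t y"
    "knows j t (x - y) \<longleftrightarrow> knows j t x \<and> knows j t y" "knows j t (- x) \<longleftrightarrow> knows j t x"
    "knows j t (x * y) \<longleftrightarrow> knows j t x \<and> knows j t y"
    "knows j t (truncate d z) \<longleftrightarrow> knows j t z"
    "knows j t (held_by S s v) \<longleftrightarrow> j \<in> S \<and> stage_index s \<le> stage_index t"
    "knows j t (deliver s i k w) \<longleftrightarrow>
      knows j t w \<or> j = k \<and> stage_index s \<le> stage_index t \<and> knows i s w"
proof -
  have "sup p q = \<infinity> \<longleftrightarrow> p = \<infinity> \<or> q = \<infinity>" "min p q = \<infinity> \<longleftrightarrow> p = \<infinity> \<and> q = \<infinity>" for p q :: enat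
    by (cases p; cases q; simp add: sup_enat_def min_def)+
  then show "knows j t (0 :: 'r wire)" "knows j t (x + y) \<longleftrightarrow> knows j t x \<and> knows j t y"
    "knows j t (x - y) \<longleftrightarrow> knows j t x \<and> knows j t y" "knows j t (- x) \<longleftrightarrow> knows j t x"
    "knows j t (x * y) \<longleftrightarrow> knows j t x \<and> knows j t y"
    "knows j t (truncate d z) \<longleftrightarrow> knows j t z"
    "knows j t (held_by S s v) \<longleftrightarrow> j \<in> S \<and> stage_index s \<le> stage_index t"
    "knows j t (deliver s i k w) \<longleftrightarrow>
      knows j t w \<or> j = k \<and> stage_index s \<le> stage_index t \<and> knows i s w"
    by (auto simp add: knows_def zero_wire_def plus_wire_def minus_wire_def uminus_wire_def
        times_wire_def truncate_def held_by_def deliver_def plus_eq_infty_iff_enat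
        simp del: not_infinity_eq)
qed

lemma mult3_feasible:
  "list_all feasible (transcript (mult3 \<rho> d isTr (share a la) (share b lb) (share c lc)))"
  apply (cases la; cases lb; cases lc)
  apply (simp add: run_simps)
  apply (simp add: knows_simps)
  done

lemma mult3_correct:
  "shared_value (result (mult3 \<rho> d False (share a la) (share b lb) (share c lc))) = a * b * c"
  apply (cases la; cases lb; cases lc)
  apply (simp add: run_simps)
  apply (simp add: val_simps algebra_simps)
  done

end

(* One instance sends nine ring elements in preprocessing, and y1, y2 and the masked value p online;
   all hashes together form at most 16 messages, whatever the number N of instances, and vanish
   after division by N. Neither y1 nor y2 depends on an online message, so both are sent in
   round 1. *)

theory Submission
  imports Defs
begin

text \<open>The part of \<open>communication\<close> without hashes. It is split off because it is
  additive over concatenated transcripts, unlike the batched hashes.\<close>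

definition payload :: "stage set \<Rightarrow> 'l::len word event list \<Rightarrow> nat" where
  "payload S es = sum_list (map length (concat (map (sent_data S) es)))"

lemma payload_simps [simp]:
  fixes w :: "'l::len word wire"
  shows "payload S ([] :: 'l word event list) = 0"
    "payload S (Send s i k w # es) = (if s \<in> S then LENGTH('l) else 0) + payload S es"
    "payload S (Digest s j k w w' # es) = payload S es"
    "payload S (es @ es') = payload S es + payload S es'"
  by (simp_all add: payload_def bits_def)

lemma payload_concat: "payload S (concat ess) = (\<Sum>es\<leftarrow>ess. payload S es)"
  by (induction ess) simp_all

lemma sum_list_length_concat_map_le:
  assumes "\<And>x. sum_list (map length (f x)) \<le> b"
  shows "sum_list (map length (concat (map f xs))) \<le> length xs * b"
  using assms by (induction xs) (simp_all add: add_mono)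

text \<open>Each ordered pair of sender and receiver contributes at most one hash, so 4 * 4 hashes
  suffice however long \<open>es\<close> is.\<close>

lemma hash_messages_bound:
  assumes "\<And>x. length (H x) = h"
  shows "sum_list (map length (hash_messages H S es)) \<le> 16 * h"
proof -
  have "sum_list (map length (hash_messages H S es)) \<le> length [P0, P1, P2, P3] * (4 * h)"
    unfolding hash_messages_def
    \<comment> \<open>The comprehension is a nested \<open>concat (map ...)\<close>: the outer one
      runs over senders, worth at most \<open>4 * h\<close> each, the inner one over receivers, each
      giving one hash or none.\<close>
    by (rule sum_list_length_concat_map_le,
        rule order_trans[OF sum_list_length_concat_map_le[where b = h]])
      (simp_all add: assms)
  then show ?thesis
    by simp
qed

lemma communication_bounds:
  assumes "\<And>x. length (H x) = h"
  shows "payload S es \<le> communication H S es"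
    and "communication H S es \<le> payload S es + 16 * h"
  using hash_messages_bound[of H h S es, OF assms]
  by (simp_all add: communication_def payload_def)

lemma amortized_communication:
  fixes es :: "nat \<Rightarrow> 'l::len word event list"
  assumes H: "\<And>x. length (H x) = h" and p: "\<And>n. payload S (es n) = k"
  shows "(\<lambda>N. real (communication H S (concat (map es [0..<N]))) / real N) \<longlonglongrightarrow> real k"
proof (rule tendsto_sandwich)
  let ?c = "\<lambda>N. communication H S (concat (map es [0..<N]))"
  have payload: "payload S (concat (map es [0..<N])) = N * k" for N
    by (simp add: payload_concat o_def p sum_list_triv)
  have lower: "real N * real k \<le> real (?c N)" for N
    using communication_bounds(1)[of H h S, OF H, of "concat (map es [0..<N])"]
    by (simp add: payload flip: of_nat_mult)
  have upper: "real (?c N) \<le> real N * real k + real h * 16" for N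
    using of_nat_mono[OF communication_bounds(2)[of H h S, OF H, of "concat (map es [0..<N])"],
        where 'a = real]
    by (simp add: payload)
  \<comment> \<open>Division by zero makes the quotient 0 at \<open>N = 0\<close>, where this bound
    fails for positive \<open>k\<close>; hence only \<open>N > 0\<close> is considered.\<close>
  show "\<forall>\<^sub>F N in sequentially. real k \<le> real (?c N) / real N"
    using eventually_gt_at_top[of 0] by eventually_elim (simp add: field_simps lower)
  show "\<forall>\<^sub>F N in sequentially. real (?c N) / real N \<le> real k + 16 * real h / real N"
    using eventually_gt_at_top[of 0] by eventually_elim (simp add: field_simps upper)
  show "(\<lambda>N. real k + 16 * real h / real N) \<longlonglongrightarrow> real k"
    using tendsto_add[OF tendsto_const lim_const_over_n[of "16 * real h"], of "real k"] by simp
qed simp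

text \<open>Symbolic execution gives a list of sends whose shape depends on neither values nor
  \<open>isTr\<close>. Preprocessing has 3 in \<open>mulR\<close>, 2 in each of two calls of
  \<open>gamma_pair\<close>, \<open>wabc\<close>, and 1 in \<open>jsh_03\<close>.\<close>

lemma payload_mult3:
  fixes a b c :: "'l::len word"
  assumes "es = transcript (mult3 \<rho> d isTr (share a la) (share b lb) (share c lc))"
  shows "payload {Preprocessing} es = 9 * LENGTH('l)"
    and "payload {Online, Verification} es = 3 * LENGTH('l)"
  by (cases la; cases lb; cases lc; simp add: assms run_simps)+

text \<open>Stronger than \<open>knows\<close>, which only asks for finite availability: here no
  online message may be awaited.\<close>

definition ready :: "party \<Rightarrow> 'r wire \<Rightarrow> bool" where
  "ready i w \<longleftrightarrow> avail w i Online = 0"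

text \<open>Availability of a combined wire is a maximum, which is 0 only if both operands have 0; a
  message delivered in preprocessing costs no online round.\<close>

lemma ready_simps:
  fixes x y :: "'r::ring wire"
  shows "ready i (x + y) \<longleftrightarrow> ready i x \<and> ready i y"
    "ready i (x - y) \<longleftrightarrow> ready i x \<and> ready i y"
    "ready i (- x) \<longleftrightarrow> ready i x"
    "ready i (x * y) \<longleftrightarrow> ready i x \<and> ready i y"
    "ready i (held_by S s v) \<longleftrightarrow> i \<in> S \<and> s \<noteq> Verification"
    "ready i (deliver Preprocessing j k w) \<longleftrightarrow>
      ready i w \<or> i = k \<and> knows j Preprocessing w"
proof -
  have "sup p q = 0 \<longleftrightarrow> p = 0 \<and> q = 0" "min p q = 0 \<longleftrightarrow> p = 0 \<or> q = 0" for p q :: enat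
    by (auto simp: sup_enat_def min_def max_def)
  then show "ready i (x + y) \<longleftrightarrow> ready i x \<and> ready i y"
    "ready i (x - y) \<longleftrightarrow> ready i x \<and> ready i y"
    "ready i (- x) \<longleftrightarrow> ready i x"
    "ready i (x * y) \<longleftrightarrow> ready i x \<and> ready i y"
    "ready i (held_by S s v) \<longleftrightarrow> i \<in> S \<and> s \<noteq> Verification"
    "ready i (deliver Preprocessing j k w) \<longleftrightarrow>
      ready i w \<or> i = k \<and> knows j Preprocessing w"
    by (cases s; auto simp: ready_def knows_def plus_wire_def minus_wire_def uminus_wire_def
        times_wire_def held_by_def deliver_def simp del: not_infinity_eq)+
qed

fun send_ready :: "'r event \<Rightarrow> bool" where
  "send_ready (Send s i k w) \<longleftrightarrow> s = Online \<longrightarrow> ready i w"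
| "send_ready (Digest s j k w w') \<longleftrightarrow> True"

fun online_send :: "'r event \<Rightarrow> bool" where
  "online_send (Send s i k w) \<longleftrightarrow> s = Online"
| "online_send (Digest s j k w w') \<longleftrightarrow> False"

text \<open>Every online send happens in round 0 + 1. The existence assumption is there because the
  supremum of the empty set would be 0.\<close>

lemma rounds_Online_eq_1:
  assumes ready: "list_all send_ready es" and sent: "list_ex online_send es"
  shows "rounds Online es = 1"
proof -
  have "avail w i Online = 0" if "Send Online i k w \<in> set es" for i k w
    using ready that by (force simp: list_all_iff ready_def)
  moreover obtain i k w where "Send Online i k w \<in> set es"
    using sent by (auto simp: list_ex_iff elim!: online_send.elims)
  ultimately have "{avail w i Online + 1 | i k w. Send Online i k w \<in> set es} = {1}"
    by force
  then show ?thesis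
    by (simp add: rounds_def)
qed

lemma rounds_mult3:
  "rounds Online (transcript (mult3 \<rho> d isTr (share a la) (share b lb) (share c lc))) = 1"
proof (rule rounds_Online_eq_1)
  let ?t = "transcript (mult3 \<rho> d isTr (share a la) (share b lb) (share c lc))"
  show "list_all send_ready ?t"
    apply (cases la; cases lb; cases lc)
    apply (simp add: run_simps)
    \<comment> \<open>\<open>knows_simps\<close> settles whether the senders of the preprocessing
      messages entering \<open>y1\<close> and \<open>y2\<close> could compute them.\<close>
    apply (simp add: ready_simps knows_simps)
    done
  show "list_ex online_send ?t"
    by (cases la; cases lb; cases lc; simp add: run_simps)
qed

text \<open>Inputs and coins may vary with the instance, as the payload does not depend on them.
  \<open>Verification\<close> is charged to the online bits because the message carrying the masked
  \<open>p\<close> is deferred there, while \<open>rounds\<close> is taken for \<open>Online\<close>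
  alone.\<close>

theorem lemmaC2:
  fixes H :: "bool list \<Rightarrow> bool list"
    and hash_length d :: nat
    and isTr :: bool
    and a b c :: "nat \<Rightarrow> 'l::len word"
    and la lb lc :: "nat \<Rightarrow> 'l word \<times> 'l word \<times> 'l word"
    and \<rho> :: "nat \<Rightarrow> 'l word coins"
    and instance_transcript :: "nat \<Rightarrow> 'l word event list"
  assumes "\<And>x. length (H x) = hash_length"
    and "\<And>n. instance_transcript n =
      transcript (mult3 (\<rho> n) d isTr
        (share (a n) (la n)) (share (b n) (lb n)) (share (c n) (lc n)))"
  shows "(\<lambda>N. real (communication H {Preprocessing}
              (concat (map instance_transcript [0..<N]))) / real N)
           \<longlonglongrightarrow> 9 * real LENGTH('l)
    \<and> (\<forall>n. rounds Online (instance_transcript n) = 1)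
    \<and> (\<lambda>N. real (communication H {Online, Verification}
              (concat (map instance_transcript [0..<N]))) / real N)
           \<longlonglongrightarrow> 3 * real LENGTH('l)"
proof -
  have "payload {Preprocessing} (instance_transcript n) = 9 * LENGTH('l)"
    and "payload {Online, Verification} (instance_transcript n) = 3 * LENGTH('l)" for n
    by (rule payload_mult3[OF assms(2)])+
  note amortized = this[THEN amortized_communication[of H hash_length, OF assms(1)]]
  have "rounds Online (instance_transcript n) = 1" for n
    by (simp add: assms(2) rounds_mult3)
  with amortized show ?thesis
    by simp
qed

end
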